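(* There exists an LDQL query $q(?x)$ (with free variable $?x$) that cannot be expressed in NautiLOD; that is, there is no NautiLOD expression $ne$ such that for every Web of Linked Data $W=\langle D,adoc\rangle$ and all URIs $u,u'$ with $u\in\mathrm{dom}(adoc)$, $$u'\in[\![ne]\!]^u_W\quad\Longleftrightarrow\quad\{?x\mapsto u'\}\in[\![q(?x)]\!]^{\{u\}}_W .$$
   Context: **Data model.** $\mathcal U$ (URIs), $\mathcal B$ (blank nodes), $\mathcal L$ (literals), $\mathcal V$ (variables, written $?v,?x,\dots$) and $\mathcal D$ (documents) are pairwise disjoint infinite sets. An RDF triple is an element of $\mathcal T=(\mathcal U\cup\mathcal B)\times\mathcal U\times(\mathcal U\cup\mathcal B\cup\mathcal L)$; $\mathrm{uris}(t)$ is the set of URIs in the triple $t$. Each document $d$ carries a finite set of triples $\mathrm{data}(d)\subseteq\mathcal T$, distinct documents using disjoint sets of blank nodes. A Web of Linked Data is $W=\langle D,adoc\rangle$ with $D\subseteq\mathcal D$ finite and $adoc:\mathcal U\to D$ a partial surjective function with domain $\mathrm{dom}(adoc)$. When quantifying over all Webs, the assignment $\mathrm{data}$ also varies over all possibilities. The link graph $\mathcal G_W$ has node set $D$ and edges $\langle d,(t,u),d'\rangle$ for all $d\in D$, $t\in\mathrm{data}(d)$, $u\in\mathrm{uris}(t)\cap\mathrm{dom}(adoc)$, $d'=adoc(u)$. **SPARQL.** A solution mapping $\mu$ is a partial function with finite domain from $\mathcal V$ to $\mathcal U\cup\mathcal B\cup\mathcal L$; $\mu[\alpha]=\mu(\alpha)$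 if $\alpha\in\mathrm{dom}(\mu)$, else $\mu[\alpha]=\alpha$ (extended componentwise to triples). $\mu,\mu'$ are compatible if they agree on $\mathrm{dom}(\mu)\cap\mathrm{dom}(\mu')$. $\Omega_1\Join\Omega_2=\{\mu_1\cup\mu_2\mid\mu_i\in\Omega_i\text{ compatible}\}$. An RDF dataset $\mathfrak D$ consists of a default graph and finitely or infinitely many named graphs $\langle u,G_u\rangle$ with pairwise distinct names $u\in\mathcal U$. Graph patterns: finite sets $B$ of triple patterns from $(\mathcal U\cup\mathcal L\cup\mathcal V)\times(\mathcal U\cup\mathcal V)\times(\mathcal U\cup\mathcal L\cup\mathcal V)$ (basic graph patterns, possibly the empty one $\{\,\}$; a triple pattern is identified with a singleton), and $(P_1\,\mathsf{AND}\,P_2)$, $(P_1\,\mathsf{UNION}\,P_2)$, $(P_1\,\mathsf{OPT}\,P_2)$, $(P_1\,\mathsf{FILTER}\,R)$, $(\mathsf{GRAPH}\ c\ P_1)$ with $c\in\mathcal U\cup\mathcal V$, $(P_1\,\mathsf{BIND}(e\,\mathsf{AS}\,?v))$ with $e\in\mathcal U\cup\mathcal L\cup\mathcal V$ and $?v$ not occurring in $P_1$. Filter conditions are Boolean combinations of $\mathrm{bound}(?x)$, $?x=c$, $?x=?y$ (atoms with an unbound variable are false). Evaluation $[\![P]\!]^{\mathfrak D}_G$: $[\![B]\!]=\{\mu\mid\mathrm{dom}(\mu)=\mathrm{var}(B),\mu[B]\subseteq G\}$; $\mathsf{AND}$ is $\Join$; $\mathsf{UNION}$ is $\cup$; $\mathsf{OPT}$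 gives $(\Omega_1\Join\Omega_2)\cup\{\mu\in\Omega_1\mid\text{no }\mu'\in\Omega_2\text{ compatible with }\mu\}$; $\mathsf{FILTER}$ selects the mappings satisfying $R$; $[\![\mathsf{GRAPH}\ u\ P_1]\!]^{\mathfrak D}_G=[\![P_1]\!]^{\mathfrak D}_{G_u}$ ($G_u=\emptyset$ if $u$ is not a name in $\mathfrak D$); $[\![\mathsf{GRAPH}\ ?x\ P_1]\!]^{\mathfrak D}_G=\bigcup_{u\text{ name in }\mathfrak D}([\![P_1]\!]^{\mathfrak D}_{G_u}\Join\{\{?x\mapsto u\}\})$; $\mathsf{BIND}$ extends each mapping $\mu$ by $?v\mapsto\mu[e]$ (leaving $\mu$ unchanged if $e$ is an unbound variable). $[\![P]\!]_G$ (without dataset) means evaluation over $G$ in the dataset with default graph $G$ and no named graphs. **LDQL.** A link pattern is a tuple in $(\mathcal U\cup\{\_,+\})\times(\mathcal U\cup\{\_,+\})\times(\mathcal U\cup\mathcal L\cup\{\_,+\})$. An edge with label $(\langle x_1,x_2,x_3\rangle,u)$ matches $\langle y_1,y_2,y_3\rangle$ in the context of URI $u_c$ if (1) some $i$ has $y_i=\_$ and $x_i=u$, and (2) for each $i$: $y_i=+$ and $x_i=u_c$, or $y_i=x_i$, or $y_i=\_$. LDQL queries $q$ and link path expressions (LPEs) $lpe$ are given by $q:=\langle lpe,P\rangle\mid(\mathsf{SEED}\ U\ q)\mid(\mathsf{SEED}\ ?v\ q)\mid(q\,\mathsf{AND}\,q)\mid(q\,\mathsf{UNION}\,q)\mid\pi_Vq$,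 $lpe:=\varepsilon\mid lp\mid lpe/lpe\mid lpe|lpe\mid lpe^*\mid[lpe]\mid\langle ?v,q\rangle$, with $lp$ a link pattern, $P$ a graph pattern, $U$ a finite set of URIs, $V$ a finite set of variables. $\mathrm{dataset}_W(U)$ is the dataset with default graph $\bigcup_{u\in U\cap\mathrm{dom}(adoc)}\mathrm{data}(adoc(u))$ and named graphs $\langle u,\mathrm{data}(adoc(u))\rangle$ for $u\in U\cap\mathrm{dom}(adoc)$. For finite $S\subseteq\mathcal U$: $[\![\langle lpe,P\rangle]\!]^S_W=[\![P]\!]^{\mathfrak D}_G$ with $\mathfrak D=\mathrm{dataset}_W(\bigcup_{u\in S}[\![lpe]\!]^u_W)$ and $G$ its default graph; $[\![(\mathsf{SEED}\ U\ q)]\!]^S_W=[\![q]\!]^U_W$; $[\![(\mathsf{SEED}\ ?v\ q)]\!]^S_W=\bigcup_{u\in\mathcal U}([\![q]\!]^{\{u\}}_W\Join\{\{?v\mapsto u\}\})$; $\mathsf{UNION}$ is $\cup$; $\mathsf{AND}$ is $\Join$; $[\![\pi_Vq]\!]^S_W$ consists of the restrictions of the mappings in $[\![q]\!]^S_W$ to $V$. For $u_c\in\mathrm{dom}(adoc)$: $[\![\varepsilon]\!]^{u_c}_W=\{u_c\}$; $[\![lp]\!]^{u_c}_W$ is the set of URIs $u$ such that some edge $\langle adoc(u_c),(t,u),d'\rangle\in\mathcal G_W$ matches $lp$ in the context of $u_c$; $[\![l_1/l_2]\!]^{u_c}_W=\bigcup_{u'\in[\![l_1]\!]^{u_c}_W}[\![l_2]\!]^{u'}_W$;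 $[\![l_1|l_2]\!]^{u_c}_W$ is the union; $[\![l^*]\!]^{u_c}_W=\{u_c\}\cup[\![l]\!]^{u_c}_W\cup[\![l/l]\!]^{u_c}_W\cup\cdots$; $[\![[l]]\!]^{u_c}_W=\{u_c\}$ if $[\![l]\!]^{u_c}_W\ne\emptyset$, else $\emptyset$; $[\![\langle ?v,q\rangle]\!]^{u_c}_W=\{u\in\mathcal U\mid\mu(?v)=u\text{ for some }\mu\in[\![q]\!]^{\{u_c\}}_W\}$. If $u_c\notin\mathrm{dom}(adoc)$ then $[\![lpe]\!]^{u_c}_W=\emptyset$. Writing $q(?x)$ means that $?x$ is the single free variable of $q$: every solution mapping in every $[\![q]\!]^S_W$ has domain contained in $\{?x\}$. **NautiLOD (without actions).** Expressions: $ne:=p\mid p\text{\textasciicircum}\mid\langle\_\rangle\mid ne/ne\mid ne|ne\mid ne^*\mid ne[(\mathsf{ASK}\ P)]$ with $p\in\mathcal U$ and $P$ a SPARQL graph pattern. For $u\in\mathrm{dom}(adoc)$: - $[\![p]\!]^u_W=\{u'\mid\langle u,p,u'\rangle\in\mathrm{data}(adoc(u))\}$; - $[\![p\text{\textasciicircum}]\!]^u_W=\{u'\mid\langle u',p,u\rangle\in\mathrm{data}(adoc(u))\}$; - $[\![\langle\_\rangle]\!]^u_W=\{u'\mid\langle u,p,u'\rangle\in\mathrm{data}(adoc(u))\text{ for some }p\in\mathcal U\}$; - $[\![ne_1/ne_2]\!]^u_W=\{u''\mid u''\in[\![ne_2]\!]^{u'}_W\text{ for some }u'\in[\![ne_1]\!]^u_W\text{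 with }u'\in\mathrm{dom}(adoc)\}$; - $[\![ne_1|ne_2]\!]^u_W=[\![ne_1]\!]^u_W\cup[\![ne_2]\!]^u_W$; - $[\![ne^*]\!]^u_W=\{u\}\cup[\![ne]\!]^u_W\cup[\![ne/ne]\!]^u_W\cup\cdots$; - $[\![ne[(\mathsf{ASK}\ P)]]\!]^u_W=\{u'\in[\![ne]\!]^u_W\mid u'\in\mathrm{dom}(adoc),\ [\![P]\!]_{\mathrm{data}(adoc(u'))}\ne\emptyset\}$. *)

theory Defs
  imports "HOL-Library.FSet" "HOL-Library.Infinite_Typeclass"
begin

section \<open>RDF and Webs of Linked Data\<close>

text \<open>
  URIs, blank nodes, literals, variables and documents are the elements of five types
  \<open>'u\<close>, \<open>'b\<close>, \<open>'l\<close>, \<open>'v\<close>, \<open>'d\<close>, which the main statement requires to be infinite. Disjointness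
  is ensured by the constructors that embed them into common types.
\<close>

datatype ('u, 'b, 'l) rdf_term = Uri 'u | Blank 'b | Lit 'l

type_synonym ('u, 'b, 'l) triple =
  "('u, 'b, 'l) rdf_term \<times> ('u, 'b, 'l) rdf_term \<times> ('u, 'b, 'l) rdf_term"

definition rdf_triples :: "('u, 'b, 'l) triple set" where
  "rdf_triples = (range Uri \<union> range Blank) \<times> range Uri \<times> UNIV"

fun triple_uris :: "('u, 'b, 'l) triple \<Rightarrow> 'u set" where
  "triple_uris (s, p, o') = {u. Uri u \<in> {s, p, o'}}"

fun triple_blanks :: "('u, 'b, 'l) triple \<Rightarrow> 'b set" where
  "triple_blanks (s, p, o') = {b. Blank b \<in> {s, p, o'}}"

text \<open>
  The assignment of data to documents is part of the structure, so that quantifying over all Webs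
  also quantifies over all such assignments. It is defined on all documents, not only on those
  of the Web.
\<close>

record ('u, 'b, 'l, 'd) web =
  docs :: "'d set"
  adoc :: "'u \<Rightarrow> 'd option"
  data :: "'d \<Rightarrow> ('u, 'b, 'l) triple set"

definition is_web :: "('u, 'b, 'l, 'd) web \<Rightarrow> bool" where
  "is_web W \<longleftrightarrow>
     finite (docs W) \<and> ran (adoc W) = docs W \<and>
     (\<forall>d. finite (data W d) \<and> data W d \<subseteq> rdf_triples) \<and>
     (\<forall>d d'. d \<noteq> d' \<longrightarrow>
        (\<Union>t\<in>data W d. triple_blanks t) \<inter> (\<Union>t\<in>data W d'. triple_blanks t) = {})"

definition link_graph ::
    "('u, 'b, 'l, 'd) web \<Rightarrow> ('d \<times> (('u, 'b, 'l) triple \<times> 'u) \<times> 'd) set" where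
  "link_graph W =
     {(d, (t, u), d'). d \<in> docs W \<and> t \<in> data W d \<and> u \<in> triple_uris t \<and> adoc W u = Some d'}"


section \<open>SPARQL\<close>

text \<open>URIs and literals, i.e. the constants that may occur in patterns.\<close>

datatype ('u, 'l) const = CUri 'u | CLit 'l

fun const_term :: "('u, 'l) const \<Rightarrow> ('u, 'b, 'l) rdf_term" where
  "const_term (CUri u) = Uri u"
| "const_term (CLit l) = Lit l"

datatype ('c, 'v) pterm = Cst 'c | Var 'v

fun pterm_vars :: "('c, 'v) pterm \<Rightarrow> 'v set" where
  "pterm_vars (Cst c) = {}"
| "pterm_vars (Var v) = {v}"

type_synonym ('u, 'l, 'v) triple_pattern =
  "(('u, 'l) const, 'v) pterm \<times> ('u, 'v) pterm \<times> (('u, 'l) const, 'v) pterm"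

fun tp_vars :: "('u, 'l, 'v) triple_pattern \<Rightarrow> 'v set" where
  "tp_vars (s, p, o') = pterm_vars s \<union> pterm_vars p \<union> pterm_vars o'"

text \<open>
  Solution mappings are partial functions; all those arising in evaluations have finite domain
  (lemmas \<open>finite_dom_eval_gp\<close> and \<open>finite_dom_eval_query\<close> below).
\<close>

type_synonym ('u, 'b, 'l, 'v) mapping = "'v \<Rightarrow> ('u, 'b, 'l) rdf_term option"

definition compatible ::
    "('u, 'b, 'l, 'v) mapping \<Rightarrow> ('u, 'b, 'l, 'v) mapping \<Rightarrow> bool" where
  "compatible \<mu> \<mu>' \<longleftrightarrow> (\<forall>v \<in> dom \<mu> \<inter> dom \<mu>'. \<mu> v = \<mu>' v)"

definition join ::
    "('u, 'b, 'l, 'v) mapping set \<Rightarrow> ('u, 'b, 'l, 'v) mapping set \<Rightarrow> ('u, 'b, 'l, 'v) mapping set"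
    (infixl "\<Join>" 70) where
  "\<Omega>\<^sub>1 \<Join> \<Omega>\<^sub>2 = {\<mu>\<^sub>1 ++ \<mu>\<^sub>2 | \<mu>\<^sub>1 \<mu>\<^sub>2. \<mu>\<^sub>1 \<in> \<Omega>\<^sub>1 \<and> \<mu>\<^sub>2 \<in> \<Omega>\<^sub>2 \<and> compatible \<mu>\<^sub>1 \<mu>\<^sub>2}"

text \<open>
  Application of a solution mapping. The value \<open>None\<close> represents the case in which an unbound
  variable is left in place.
\<close>

fun app_pterm ::
    "('c \<Rightarrow> ('u, 'b, 'l) rdf_term) \<Rightarrow> ('u, 'b, 'l, 'v) mapping \<Rightarrow> ('c, 'v) pterm
      \<Rightarrow> ('u, 'b, 'l) rdf_term option" where
  "app_pterm emb \<mu> (Cst c) = Some (emb c)"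
| "app_pterm emb \<mu> (Var v) = \<mu> v"

fun app_tp ::
    "('u, 'b, 'l, 'v) mapping \<Rightarrow> ('u, 'l, 'v) triple_pattern \<Rightarrow> ('u, 'b, 'l) triple option" where
  "app_tp \<mu> (s, p, o') =
     (case (app_pterm const_term \<mu> s, app_pterm Uri \<mu> p, app_pterm const_term \<mu> o') of
        (Some s', Some p', Some o'') \<Rightarrow> Some (s', p', o'')
      | _ \<Rightarrow> None)"

datatype ('u, 'l, 'v) filter_cond =
    Bound 'v
  | EqConst 'v "('u, 'l) const"
  | EqVar 'v 'v
  | FNot "('u, 'l, 'v) filter_cond"
  | FAnd "('u, 'l, 'v) filter_cond" "('u, 'l, 'v) filter_cond"
  | FOr "('u, 'l, 'v) filter_cond" "('u, 'l, 'v) filter_cond"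

primrec filter_vars :: "('u, 'l, 'v) filter_cond \<Rightarrow> 'v set" where
  "filter_vars (Bound x) = {x}"
| "filter_vars (EqConst x c) = {x}"
| "filter_vars (EqVar x y) = {x, y}"
| "filter_vars (FNot R) = filter_vars R"
| "filter_vars (FAnd R1 R2) = filter_vars R1 \<union> filter_vars R2"
| "filter_vars (FOr R1 R2) = filter_vars R1 \<union> filter_vars R2"

primrec satisfies :: "('u, 'b, 'l, 'v) mapping \<Rightarrow> ('u, 'l, 'v) filter_cond \<Rightarrow> bool" where
  "satisfies \<mu> (Bound x) \<longleftrightarrow> x \<in> dom \<mu>"
| "satisfies \<mu> (EqConst x c) \<longleftrightarrow> \<mu> x = Some (const_term c)"
| "satisfies \<mu> (EqVar x y) \<longleftrightarrow> x \<in> dom \<mu> \<and> y \<in> dom \<mu> \<and> \<mu> x = \<mu> y"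
| "satisfies \<mu> (FNot R) \<longleftrightarrow> \<not> satisfies \<mu> R"
| "satisfies \<mu> (FAnd R1 R2) \<longleftrightarrow> satisfies \<mu> R1 \<and> satisfies \<mu> R2"
| "satisfies \<mu> (FOr R1 R2) \<longleftrightarrow> satisfies \<mu> R1 \<or> satisfies \<mu> R2"

datatype ('u, 'l, 'v) graph_pattern =
    BGP "('u, 'l, 'v) triple_pattern fset"
  | PAnd "('u, 'l, 'v) graph_pattern" "('u, 'l, 'v) graph_pattern"
  | PUnion "('u, 'l, 'v) graph_pattern" "('u, 'l, 'v) graph_pattern"
  | POpt "('u, 'l, 'v) graph_pattern" "('u, 'l, 'v) graph_pattern"
  | PFilter "('u, 'l, 'v) graph_pattern" "('u, 'l, 'v) filter_cond"
  | PGraph "('u, 'v) pterm" "('u, 'l, 'v) graph_pattern"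
  | PBind "('u, 'l, 'v) graph_pattern" "(('u, 'l) const, 'v) pterm" 'v

primrec gp_vars :: "('u, 'l, 'v) graph_pattern \<Rightarrow> 'v set" where
  "gp_vars (BGP B) = (\<Union>tp\<in>fset B. tp_vars tp)"
| "gp_vars (PAnd P1 P2) = gp_vars P1 \<union> gp_vars P2"
| "gp_vars (PUnion P1 P2) = gp_vars P1 \<union> gp_vars P2"
| "gp_vars (POpt P1 P2) = gp_vars P1 \<union> gp_vars P2"
| "gp_vars (PFilter P R) = gp_vars P \<union> filter_vars R"
| "gp_vars (PGraph c P) = pterm_vars c \<union> gp_vars P"
| "gp_vars (PBind P e v) = gp_vars P \<union> pterm_vars e \<union> {v}"

text \<open>The only syntactic restriction not enforced by the types is the one on \<open>PBind\<close>.\<close>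

primrec wf_gp :: "('u, 'l, 'v) graph_pattern \<Rightarrow> bool" where
  "wf_gp (BGP B) \<longleftrightarrow> True"
| "wf_gp (PAnd P1 P2) \<longleftrightarrow> wf_gp P1 \<and> wf_gp P2"
| "wf_gp (PUnion P1 P2) \<longleftrightarrow> wf_gp P1 \<and> wf_gp P2"
| "wf_gp (POpt P1 P2) \<longleftrightarrow> wf_gp P1 \<and> wf_gp P2"
| "wf_gp (PFilter P R) \<longleftrightarrow> wf_gp P"
| "wf_gp (PGraph c P) \<longleftrightarrow> wf_gp P"
| "wf_gp (PBind P e v) \<longleftrightarrow> wf_gp P \<and> v \<notin> gp_vars P"

record ('u, 'b, 'l) dataset =
  default_graph :: "('u, 'b, 'l) triple set"
  named_graph :: "'u \<Rightarrow> ('u, 'b, 'l) triple set option"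

primrec eval_gp ::
    "('u, 'b, 'l) dataset \<Rightarrow> ('u, 'b, 'l) triple set \<Rightarrow> ('u, 'l, 'v) graph_pattern
      \<Rightarrow> ('u, 'b, 'l, 'v) mapping set" where
  "eval_gp DS G (BGP B) =
     {\<mu>. dom \<mu> = (\<Union>tp\<in>fset B. tp_vars tp) \<and> (\<forall>tp\<in>fset B. \<exists>t\<in>G. app_tp \<mu> tp = Some t)}"
| "eval_gp DS G (PAnd P1 P2) = eval_gp DS G P1 \<Join> eval_gp DS G P2"
| "eval_gp DS G (PUnion P1 P2) = eval_gp DS G P1 \<union> eval_gp DS G P2"
| "eval_gp DS G (POpt P1 P2) =
     (eval_gp DS G P1 \<Join> eval_gp DS G P2) \<union>
     {\<mu> \<in> eval_gp DS G P1. \<not> (\<exists>\<mu>' \<in> eval_gp DS G P2. compatible \<mu> \<mu>')}"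
| "eval_gp DS G (PFilter P R) = {\<mu> \<in> eval_gp DS G P. satisfies \<mu> R}"
| "eval_gp DS G (PGraph c P) =
     (case c of
        Cst u \<Rightarrow> eval_gp DS (case named_graph DS u of Some Gu \<Rightarrow> Gu | None \<Rightarrow> {}) P
      | Var x \<Rightarrow> (\<Union>u \<in> dom (named_graph DS).
                    eval_gp DS (the (named_graph DS u)) P \<Join> {[x \<mapsto> Uri u]}))"
| "eval_gp DS G (PBind P e v) =
     (\<lambda>\<mu>. case app_pterm const_term \<mu> e of Some a \<Rightarrow> \<mu>(v \<mapsto> a) | None \<Rightarrow> \<mu>) ` eval_gp DS G P"

definition eval_gp_graph ::
    "('u, 'b, 'l) triple set \<Rightarrow> ('u, 'l, 'v) graph_pattern \<Rightarrow> ('u, 'b, 'l, 'v) mapping set" where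
  "eval_gp_graph G P = eval_gp \<lparr>default_graph = G, named_graph = Map.empty\<rparr> G P"


section \<open>LDQL\<close>

datatype 'c lp_elem = Wildcard | Context | Fixed 'c

type_synonym ('u, 'l) link_pattern = "'u lp_elem \<times> 'u lp_elem \<times> ('u, 'l) const lp_elem"

fun match_elem ::
    "('c \<Rightarrow> ('u, 'b, 'l) rdf_term) \<Rightarrow> 'u \<Rightarrow> ('u, 'b, 'l) rdf_term \<Rightarrow> 'c lp_elem \<Rightarrow> bool" where
  "match_elem emb uc x Wildcard \<longleftrightarrow> True"
| "match_elem emb uc x Context \<longleftrightarrow> x = Uri uc"
| "match_elem emb uc x (Fixed c) \<longleftrightarrow> x = emb c"

fun edge_matches ::
    "'u \<Rightarrow> ('u, 'b, 'l) triple \<times> 'u \<Rightarrow> ('u, 'l) link_pattern \<Rightarrow> bool" where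
  "edge_matches uc ((x1, x2, x3), u) (y1, y2, y3) \<longleftrightarrow>
     (y1 = Wildcard \<and> x1 = Uri u \<or> y2 = Wildcard \<and> x2 = Uri u \<or> y3 = Wildcard \<and> x3 = Uri u) \<and>
     match_elem Uri uc x1 y1 \<and> match_elem Uri uc x2 y2 \<and> match_elem const_term uc x3 y3"

datatype ('u, 'l, 'v) lpe =
    Eps
  | Link "('u, 'l) link_pattern"
  | Seq "('u, 'l, 'v) lpe" "('u, 'l, 'v) lpe"
  | Alt "('u, 'l, 'v) lpe" "('u, 'l, 'v) lpe"
  | Star "('u, 'l, 'v) lpe"
  | Test "('u, 'l, 'v) lpe"
  | Sub 'v "('u, 'l, 'v) query"
and ('u, 'l, 'v) query =
    Basic "('u, 'l, 'v) lpe" "('u, 'l, 'v) graph_pattern"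
  | SeedSet "'u fset" "('u, 'l, 'v) query"
  | SeedVar 'v "('u, 'l, 'v) query"
  | QAnd "('u, 'l, 'v) query" "('u, 'l, 'v) query"
  | QUnion "('u, 'l, 'v) query" "('u, 'l, 'v) query"
  | Proj "'v fset" "('u, 'l, 'v) query"

primrec wf_lpe :: "('u, 'l, 'v) lpe \<Rightarrow> bool"
  and wf_query :: "('u, 'l, 'v) query \<Rightarrow> bool" where
  "wf_lpe Eps \<longleftrightarrow> True"
| "wf_lpe (Link lp) \<longleftrightarrow> True"
| "wf_lpe (Seq l1 l2) \<longleftrightarrow> wf_lpe l1 \<and> wf_lpe l2"
| "wf_lpe (Alt l1 l2) \<longleftrightarrow> wf_lpe l1 \<and> wf_lpe l2"
| "wf_lpe (Star l) \<longleftrightarrow> wf_lpe l"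
| "wf_lpe (Test l) \<longleftrightarrow> wf_lpe l"
| "wf_lpe (Sub v q) \<longleftrightarrow> wf_query q"
| "wf_query (Basic l P) \<longleftrightarrow> wf_lpe l \<and> wf_gp P"
| "wf_query (SeedSet U q) \<longleftrightarrow> wf_query q"
| "wf_query (SeedVar v q) \<longleftrightarrow> wf_query q"
| "wf_query (QAnd q1 q2) \<longleftrightarrow> wf_query q1 \<and> wf_query q2"
| "wf_query (QUnion q1 q2) \<longleftrightarrow> wf_query q1 \<and> wf_query q2"
| "wf_query (Proj V q) \<longleftrightarrow> wf_query q"

definition dataset_of :: "('u, 'b, 'l, 'd) web \<Rightarrow> 'u set \<Rightarrow> ('u, 'b, 'l) dataset" where
  "dataset_of W U =
     \<lparr>default_graph = (\<Union>u \<in> U \<inter> dom (adoc W). data W (the (adoc W u))),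
      named_graph = (\<lambda>u. if u \<in> U then map_option (data W) (adoc W u) else None)\<rparr>"

primrec eval_lpe :: "('u, 'b, 'l, 'd) web \<Rightarrow> ('u, 'l, 'v) lpe \<Rightarrow> 'u \<Rightarrow> 'u set"
  and eval_query ::
    "('u, 'b, 'l, 'd) web \<Rightarrow> ('u, 'l, 'v) query \<Rightarrow> 'u set \<Rightarrow> ('u, 'b, 'l, 'v) mapping set" where
  "eval_lpe W Eps uc = (if uc \<in> dom (adoc W) then {uc} else {})"
| "eval_lpe W (Link lp) uc =
     (if uc \<in> dom (adoc W)
      then {u. \<exists>t d'. (the (adoc W uc), (t, u), d') \<in> link_graph W \<and> edge_matches uc (t, u) lp}
      else {})"
| "eval_lpe W (Seq l1 l2) uc =
     (if uc \<in> dom (adoc W) then \<Union>u' \<in> eval_lpe W l1 uc. eval_lpe W l2 u' else {})"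
| "eval_lpe W (Alt l1 l2) uc =
     (if uc \<in> dom (adoc W) then eval_lpe W l1 uc \<union> eval_lpe W l2 uc else {})"
| "eval_lpe W (Star l) uc =
     (if uc \<in> dom (adoc W)
      then \<Union>n. {u. (uc, u) \<in> {(a, b). b \<in> eval_lpe W l a} ^^ n}
      else {})"
| "eval_lpe W (Test l) uc =
     (if uc \<in> dom (adoc W) \<and> eval_lpe W l uc \<noteq> {} then {uc} else {})"
| "eval_lpe W (Sub v q) uc =
     (if uc \<in> dom (adoc W) then {u. \<exists>\<mu> \<in> eval_query W q {uc}. \<mu> v = Some (Uri u)} else {})"
| "eval_query W (Basic l P) S =
     (let DS = dataset_of W (\<Union>u\<in>S. eval_lpe W l u) in eval_gp DS (default_graph DS) P)"
| "eval_query W (SeedSet U q) S = eval_query W q (fset U)"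
| "eval_query W (SeedVar v q) S = (\<Union>u. eval_query W q {u} \<Join> {[v \<mapsto> Uri u]})"
| "eval_query W (QAnd q1 q2) S = eval_query W q1 S \<Join> eval_query W q2 S"
| "eval_query W (QUnion q1 q2) S = eval_query W q1 S \<union> eval_query W q2 S"
| "eval_query W (Proj V q) S = (\<lambda>\<mu>. \<mu> |` fset V) ` eval_query W q S"


section \<open>NautiLOD without actions\<close>

datatype ('u, 'l, 'v) nautilod =
    NPred 'u
  | NInv 'u
  | NAny
  | NSeq "('u, 'l, 'v) nautilod" "('u, 'l, 'v) nautilod"
  | NAlt "('u, 'l, 'v) nautilod" "('u, 'l, 'v) nautilod"
  | NStar "('u, 'l, 'v) nautilod"
  | NAsk "('u, 'l, 'v) nautilod" "('u, 'l, 'v) graph_pattern"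

primrec wf_nautilod :: "('u, 'l, 'v) nautilod \<Rightarrow> bool" where
  "wf_nautilod (NPred p) \<longleftrightarrow> True"
| "wf_nautilod (NInv p) \<longleftrightarrow> True"
| "wf_nautilod NAny \<longleftrightarrow> True"
| "wf_nautilod (NSeq ne1 ne2) \<longleftrightarrow> wf_nautilod ne1 \<and> wf_nautilod ne2"
| "wf_nautilod (NAlt ne1 ne2) \<longleftrightarrow> wf_nautilod ne1 \<and> wf_nautilod ne2"
| "wf_nautilod (NStar ne) \<longleftrightarrow> wf_nautilod ne"
| "wf_nautilod (NAsk ne P) \<longleftrightarrow> wf_nautilod ne \<and> wf_gp P"

text \<open>
  The semantics is specified only at URIs in \<open>dom (adoc W)\<close>; at other URIs the value below is
  irrelevant, since sequences (hence also the iterations of \<open>NStar\<close>) continue only from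
  intermediate URIs in \<open>dom (adoc W)\<close>.
\<close>

primrec eval_nautilod :: "('u, 'b, 'l, 'd) web \<Rightarrow> ('u, 'l, 'v) nautilod \<Rightarrow> 'u \<Rightarrow> 'u set" where
  "eval_nautilod W (NPred p) u = {u'. (Uri u, Uri p, Uri u') \<in> data W (the (adoc W u))}"
| "eval_nautilod W (NInv p) u = {u'. (Uri u', Uri p, Uri u) \<in> data W (the (adoc W u))}"
| "eval_nautilod W NAny u = {u'. \<exists>p. (Uri u, Uri p, Uri u') \<in> data W (the (adoc W u))}"
| "eval_nautilod W (NSeq ne1 ne2) u =
     (\<Union>u' \<in> eval_nautilod W ne1 u \<inter> dom (adoc W). eval_nautilod W ne2 u')"
| "eval_nautilod W (NAlt ne1 ne2) u = eval_nautilod W ne1 u \<union> eval_nautilod W ne2 u"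
| "eval_nautilod W (NStar ne) u =
     (\<Union>n. {u'. (u, u') \<in> {(a, b). a \<in> dom (adoc W) \<and> b \<in> eval_nautilod W ne a} ^^ n})"
| "eval_nautilod W (NAsk ne P) u =
     {u' \<in> eval_nautilod W ne u \<inter> dom (adoc W).
        (eval_gp_graph (data W (the (adoc W u'))) P :: ('u, 'b, 'l, 'v) mapping set) \<noteq> {}}"


section \<open>Finiteness of solution mappings\<close>

lemma finite_dom_join:
  assumes "\<mu> \<in> A \<Join> B" and "\<forall>\<mu>\<in>A. finite (dom \<mu>)" and "\<forall>\<mu>\<in>B. finite (dom \<mu>)"
  shows "finite (dom \<mu>)"
  using assms by (auto simp: join_def)

lemma finite_dom_eval_gp: "\<forall>\<mu> \<in> eval_gp DS G P. finite (dom \<mu>)"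
proof (induction P arbitrary: G)
  case (BGP B)
  have vars: "finite (pterm_vars e)" for e :: "('x, 'y) pterm"
    by (cases e) auto
  have "finite (tp_vars tp)" for tp :: "('x, 'z, 'y) triple_pattern"
    by (cases tp) (simp add: vars)
  then show ?case by auto
next
  case (PGraph c P)
  then show ?case
    by (cases c) (auto split: option.splits elim!: finite_dom_join)
qed (auto elim!: finite_dom_join split: option.splits)

lemma finite_dom_eval_query: "\<forall>\<mu> \<in> eval_query W q S. finite (dom \<mu>)"
  by (induction q arbitrary: S rule: query.induct[where ?P1.0 = "\<lambda>_. True"])
    (auto simp: Let_def finite_dom_eval_gp elim!: finite_dom_join)

end

theory Submission
  imports Defs
begin

text \<open>
  A NautiLOD expression can leave a URI \<open>u\<close> only along a triple that mentions \<open>u\<close>, whereas the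
  graph pattern of an LDQL query sees every triple in the document of \<open>u\<close>. The two differ on a Web
  whose only document is looked up by \<open>u\<close> and whose only triple does not mention \<open>u\<close>.
\<close>

text \<open>Each atomic step from \<open>u\<close> uses a triple with \<open>u\<close> as subject or
  object, so it yields nothing here. Only zero iterations of \<open>NStar\<close> produce
  \<open>u\<close>, and from there every composite expression stays at \<open>u\<close>.\<close>

lemma eval_nautilod_subset_singleton:
  assumes "\<forall>t \<in> data W (the (adoc W u)). u \<notin> triple_uris t"
  shows "eval_nautilod W ne u \<subseteq> {u}"
proof (induction ne)
  case (NStar ne)
  \<comment> \<open>By induction on \<open>n\<close>, the last of the iterations starts at
    \<open>u\<close> again.\<close>
  have "u' = u" if "(u, u') \<in> {(a, b). a \<in> dom (adoc W) \<and> b \<in> eval_nautilod W ne a} ^^ n" for n u'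
    using that by (induction n arbitrary: u') (use NStar in auto)
  then show ?case by auto
qed (use assms in fastforce)+

text \<open>With \<open>Eps\<close> and seed \<open>{u}\<close> the default graph is the document of
  \<open>u\<close>, and nothing ties the subject bound to \<open>x\<close> to
  \<open>u\<close>.\<close>

lemma eval_query_single_triple_pattern:
  assumes "adoc W u = Some d"
  shows "eval_query W (Basic Eps (BGP {|(Var x, Cst p, Cst c)|})) {u} =
    {[x \<mapsto> s] | s. (s, Uri p, const_term c) \<in> data W d}"
  using assms by (auto simp: Let_def dataset_of_def dom_eq_singleton_conv domI)

theorem theorem4:
  shows "\<exists>(q :: ('u::infinite, 'l::infinite, 'v::infinite) query) (x :: 'v).
    wf_query q \<and>
    (\<forall>(W :: ('u, 'b::infinite, 'l, 'd::infinite) web) S.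
       is_web W \<and> finite S \<longrightarrow> (\<forall>\<mu> \<in> eval_query W q S. dom \<mu> \<subseteq> {x})) \<and>
    \<not> (\<exists>ne :: ('u, 'l, 'v) nautilod.
         wf_nautilod ne \<and>
         (\<forall>(W :: ('u, 'b, 'l, 'd) web) u u'.
            is_web W \<and> u \<in> dom (adoc W) \<longrightarrow>
              (u' \<in> eval_nautilod W ne u \<longleftrightarrow> [x \<mapsto> Uri u'] \<in> eval_query W q {u})))"
proof -
  obtain a :: 'u where True by blast
  obtain u :: 'u where "u \<noteq> a"
    using ex_new_if_finite[OF infinite_UNIV, of "{a}"] by auto
  obtain x :: 'v and d :: 'd where True by blast
  define q :: "('u, 'l, 'v) query"
    where "q = Basic Eps (BGP {|(Var x, Cst a, Cst (CUri a))|})"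
  \<comment> \<open>Using \<open>a\<close> in all three positions keeps \<open>u\<close> out of the
    triple. As it has no blank node, the disjointness condition is trivial.\<close>
  define W :: "('u, 'b, 'l, 'd) web"
    where "W = \<lparr>docs = {d}, adoc = [u \<mapsto> d],
      data = (\<lambda>d'. if d' = d then {(Uri a, Uri a, Uri a)} else {})\<rparr>"
  have "is_web W"
    by (auto simp: is_web_def W_def rdf_triples_def)
  have "u \<in> dom (adoc W)"
    by (simp add: W_def)
  have "[x \<mapsto> Uri a] \<in> eval_query W q {u}"
    unfolding q_def by (subst eval_query_single_triple_pattern[of _ _ d]) (auto simp: W_def)
  moreover have "a \<notin> eval_nautilod W ne u" for ne :: "('u, 'l, 'v) nautilod"
    using eval_nautilod_subset_singleton[of W u ne] \<open>u \<noteq> a\<close> by (auto simp: W_def)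
  ultimately have "\<not> (\<exists>ne :: ('u, 'l, 'v) nautilod.
         wf_nautilod ne \<and>
         (\<forall>(W :: ('u, 'b, 'l, 'd) web) u u'.
            is_web W \<and> u \<in> dom (adoc W) \<longrightarrow>
              (u' \<in> eval_nautilod W ne u \<longleftrightarrow> [x \<mapsto> Uri u'] \<in> eval_query W q {u})))"
    using \<open>is_web W\<close> \<open>u \<in> dom (adoc W)\<close> by blast
  moreover have "wf_query q"
    by (simp add: q_def)
  moreover have "\<forall>\<mu> \<in> eval_query W' q S. dom \<mu> \<subseteq> {x}" for W' :: "('u, 'b, 'l, 'd) web" and S
    by (simp add: q_def Let_def)
  ultimately show ?thesis by blast
qed

end
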